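(* Let $\varepsilon>0$ and let $D=D(d)$ satisfy $D=O(d^{1/2-\varepsilon})$. Let $U$ be a $d'$-dimensional normed space such that for every $d$-dimensional normed space $X$ there exists a distribution $\mathcal{D}$ supported on linear maps $f:\mathbb{R}^d\to\mathbb{R}^{d'}$ such that for every $x\in\mathbb{R}^d$, \[\|x\|_X\le\|f(x)\|_U\le D\|x\|_X\] holds with probability at least $2/3$ over $f\sim\mathcal{D}$. Then $d'=\exp(\Omega(d^{2\varepsilon}))$. *)

theory Defs
  imports "HOL-Probability.Probability" "HOL-Analysis.Abstract_Euclidean_Space"
    "HOL-Library.Landau_Symbols"
begin

abbreviation Rn :: "nat \<Rightarrow> (nat \<Rightarrow> real) set" where
  "Rn n \<equiv> topspace (Euclidean_space n)"

text \<open>Up to isometry, the \<open>n\<close>-dimensional normed spaces are \<open>\<real>\<^sup>n\<close> with a norm on it;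
  values of the norm outside \<open>Rn n\<close> are irrelevant.\<close>

definition norm_on :: "nat \<Rightarrow> ((nat \<Rightarrow> real) \<Rightarrow> real) \<Rightarrow> bool" where
  "norm_on n N \<longleftrightarrow>
     (\<forall>x\<in>Rn n. 0 \<le> N x) \<and>
     (\<forall>x\<in>Rn n. N x = 0 \<longleftrightarrow> x = (\<lambda>_. 0)) \<and>
     (\<forall>c. \<forall>x\<in>Rn n. N (\<lambda>i. c * x i) = \<bar>c\<bar> * N x) \<and>
     (\<forall>x\<in>Rn n. \<forall>y\<in>Rn n. N (\<lambda>i. x i + y i) \<le> N x + N y)"

definition lin_maps :: "nat \<Rightarrow> nat \<Rightarrow> ((nat \<Rightarrow> real) \<Rightarrow> (nat \<Rightarrow> real)) set" where
  "lin_maps m n =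
     {f \<in> Rn m \<rightarrow>\<^sub>E Rn n.
        (\<forall>x\<in>Rn m. \<forall>y\<in>Rn m. f (\<lambda>i. x i + y i) = (\<lambda>i. f x i + f y i)) \<and>
        (\<forall>c. \<forall>x\<in>Rn m. f (\<lambda>i. c * x i) = (\<lambda>i. c * f x i))}"

text \<open>The sigma-algebra generated by the maps \<open>f \<mapsto> f x i\<close>. Since these span the dual of the
  \<open>m * n\<close>-dimensional space of linear maps, it is the Borel sigma-algebra of that space. The
  events occurring in \<open>randomly_embeds\<close> belong to it, as norms on \<open>\<real>\<^sup>n\<close> are continuous.\<close>

definition lin_maps_borel :: "nat \<Rightarrow> nat \<Rightarrow> ((nat \<Rightarrow> real) \<Rightarrow> (nat \<Rightarrow> real)) measure" where
  "lin_maps_borel m n =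
     sigma (lin_maps m n)
       {{f \<in> lin_maps m n. f x i \<in> B} | x i B. x \<in> Rn m \<and> i < n \<and> B \<in> sets borel}"

definition randomly_embeds ::
  "nat \<Rightarrow> ((nat \<Rightarrow> real) \<Rightarrow> real) \<Rightarrow> nat \<Rightarrow> ((nat \<Rightarrow> real) \<Rightarrow> real) \<Rightarrow> real \<Rightarrow> bool" where
  "randomly_embeds d X d' U D \<longleftrightarrow>
     (\<exists>\<mu>. prob_space \<mu> \<and> sets \<mu> = sets (lin_maps_borel d d') \<and>
        (\<forall>x\<in>Rn d. measure \<mu> {f \<in> space \<mu>. X x \<le> U (f x) \<and> U (f x) \<le> D * X x} \<ge> 2 / 3))"

end

theory Submission
  imports Defs "HOL-Real_Asymp.Real_Asymp"
begin

text \<open>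
  Take \<open>N = exp (\<Omega>(d / D\<^sup>2))\<close> sign vectors \<open>W\<close> whose pairwise inner products are at most
  \<open>d / (2 D)\<close>. Each \<open>T \<subseteq> W\<close> gives a norm (the maximum of \<open>\<bar>\<langle>x, t\<rangle>\<bar>\<close>, \<open>t \<in> T\<close>, and a small
  multiple of the \<open>\<ell>\<^sub>1\<close> norm) equal to \<open>d\<close> on \<open>T\<close> and to \<open>d / (2 D)\<close> on \<open>W - T\<close>. By averaging, a
  single linear map \<open>f\<^sub>T\<close> is good on a set \<open>G\<^sub>T \<subseteq> W\<close> with \<open>\<bar>G\<^sub>T\<bar> \<ge> 2 N / 3\<close>, and the values
  \<open>U (f\<^sub>T u)\<close> decide membership of \<open>u \<in> G\<^sub>T\<close> in \<open>T\<close>.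

  Nothing is known about \<open>f\<^sub>T\<close> outside \<open>G\<^sub>T\<close>, so the maps are not compared on all of \<open>W\<close>.
  Instead fix \<open>S \<subseteq> W\<close>: the maps \<open>f\<^sub>T\<close> with \<open>S \<subseteq> G\<^sub>T\<close> are bounded by \<open>D d\<close> on \<open>S\<close>, and two
  of them with \<open>T \<inter> S \<noteq> T' \<inter> S\<close> differ by at least \<open>d / 2\<close> somewhere on \<open>S\<close>, so a packing bound
  \<open>M\<close> in dimension \<open>n = d d'\<close> limits the number of traces \<open>T \<inter> S\<close>. Counting the pairs
  \<open>S \<subseteq> G\<^sub>T\<close> in both orders gives \<open>2\<^sup>N 2\<^bsup>2N/3\<^esup> \<le> \<Sum>\<^sub>S M 2\<^bsup>N - \<bar>S\<bar>\<^esup> = M 3\<^sup>N\<close>. As \<open>2\<^bsup>5/3\<^esup> > 3\<close>,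
  this forces \<open>M\<close> to be exponential in \<open>N\<close>, whereas \<open>log M = O(n\<^sup>2)\<close>.
\<close>

subsection \<open>Seminorms\<close>

definition seminorm :: "(('j \<Rightarrow> real) \<Rightarrow> real) \<Rightarrow> bool" where
  "seminorm p \<longleftrightarrow> (\<forall>c x. p (\<lambda>j. c * x j) = \<bar>c\<bar> * p x) \<and> (\<forall>x y. p (\<lambda>j. x j + y j) \<le> p x + p y)"

lemma seminormI:
  assumes "\<And>c x. p (\<lambda>j. c * x j) = \<bar>c\<bar> * p x" and "\<And>x y. p (\<lambda>j. x j + y j) \<le> p x + p y"
  shows "seminorm p"
  using assms by (simp add: seminorm_def)

lemma seminorm_scale: "seminorm p \<Longrightarrow> p (\<lambda>j. c * x j) = \<bar>c\<bar> * p x"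
  by (simp add: seminorm_def)

lemma seminorm_add: "seminorm p \<Longrightarrow> p (\<lambda>j. x j + y j) \<le> p x + p y"
  by (simp add: seminorm_def)

lemma seminorm_zero: "seminorm p \<Longrightarrow> p (\<lambda>_. 0) = 0"
  using seminorm_scale[of p 0 "\<lambda>_. 0"] by simp

lemma seminorm_nonneg:
  assumes "seminorm p"
  shows "0 \<le> p x"
  using seminorm_add[OF assms, of x "\<lambda>j. - 1 * x j"] seminorm_scale[OF assms, of "- 1" x]
    seminorm_zero[OF assms] by simp

lemma seminorm_abs_diff_le:
  assumes "seminorm p"
  shows "\<bar>p x - p y\<bar> \<le> p (\<lambda>j. x j - y j)"
proof -
  have "p x \<le> p (\<lambda>j. x j - y j) + p y"
    using seminorm_add[OF assms, of "\<lambda>j. x j - y j" y] by simp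
  moreover have "p y \<le> p (\<lambda>j. y j - x j) + p x"
    using seminorm_add[OF assms, of "\<lambda>j. y j - x j" x] by simp
  moreover have "p (\<lambda>j. y j - x j) = p (\<lambda>j. x j - y j)"
    using seminorm_scale[OF assms, of "- 1" "\<lambda>j. x j - y j"] by simp
  ultimately show ?thesis by linarith
qed

lemma seminorm_linear_combination:
  assumes "seminorm p"
  shows "p (\<lambda>j. \<Sum>b\<in>B. c b * a b j) \<le> (\<Sum>b\<in>B. \<bar>c b\<bar> * p (a b))"
proof (induction B rule: infinite_finite_induct)
  case (insert b B)
  have "p (\<lambda>j. \<Sum>b\<in>insert b B. c b * a b j)
      \<le> p (\<lambda>j. c b * a b j) + p (\<lambda>j. \<Sum>b\<in>B. c b * a b j)"
    using insert.hyps seminorm_add[OF assms] by simp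
  then show ?case
    using insert seminorm_scale[OF assms, of "c b" "a b"] by simp
qed (simp_all add: seminorm_zero[OF assms])

lemma seminorm_max:
  assumes "seminorm p" "seminorm q"
  shows "seminorm (\<lambda>x. max (p x) (q x))"
proof (rule seminormI)
  show "max (p (\<lambda>j. c * x j)) (q (\<lambda>j. c * x j)) = \<bar>c\<bar> * max (p x) (q x)" for c x
    using assms by (simp add: seminorm_scale max_mult_distrib_left)
  show "max (p (\<lambda>j. x j + y j)) (q (\<lambda>j. x j + y j)) \<le> max (p x) (q x) + max (p y) (q y)" for x y
    using seminorm_add[OF assms(1), of x y] seminorm_add[OF assms(2), of x y] by linarith
qed

lemma seminorm_Max:
  assumes "finite T" "seminorm q" "\<And>t. t \<in> T \<Longrightarrow> seminorm (p t)"
  shows "seminorm (\<lambda>x. Max (insert (q x) ((\<lambda>t. p t x) ` T)))"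
  using assms
proof (induction T rule: finite_induct)
  case (insert t T)
  have "(\<lambda>x. Max (insert (q x) ((\<lambda>t. p t x) ` insert t T)))
      = (\<lambda>x. max (p t x) (Max (insert (q x) ((\<lambda>t. p t x) ` T))))"
    using insert.hyps(1) by (simp add: insert_commute[of "q _"])
  moreover have "seminorm \<dots>"
    using insert by (intro seminorm_max) auto
  ultimately show ?case by simp
qed simp

subsection \<open>Packing\<close>

text \<open>
  A variant of the approximate barycentric spanners of Awerbuch and Kleinberg, with the coefficients
  bounded in \<open>\<ell>\<^sub>1\<close> instead of individually.
\<close>

definition bounded_spanner :: "real \<Rightarrow> ('i \<Rightarrow> 'j \<Rightarrow> real) \<Rightarrow> 'i set \<Rightarrow> 'i set \<Rightarrow> bool" where
  "bounded_spanner L a I B \<longleftrightarrow> B \<subseteq> I \<and>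
     (\<exists>c. \<forall>i\<in>I. (\<Sum>b\<in>B. \<bar>c i b\<bar>) \<le> L \<and> a i = (\<lambda>j. \<Sum>b\<in>B. c i b * a b j))"

lemma bounded_spanner_mono: "bounded_spanner L a I B \<Longrightarrow> L \<le> L' \<Longrightarrow> bounded_spanner L' a I B"
  unfolding bounded_spanner_def by (meson order_trans)

lemma bounded_spanner_remove_zero:
  assumes spanner: "bounded_spanner L a I B" and "finite B" "a z = (\<lambda>_. 0)"
  shows "bounded_spanner L a I (B - {z})"
proof -
  obtain c where c: "B \<subseteq> I" "\<And>i. i \<in> I \<Longrightarrow> (\<Sum>b\<in>B. \<bar>c i b\<bar>) \<le> L"
    "\<And>i. i \<in> I \<Longrightarrow> a i = (\<lambda>j. \<Sum>b\<in>B. c i b * a b j)"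
    using spanner unfolding bounded_spanner_def by blast
  have "(\<Sum>b\<in>B - {z}. \<bar>c i b\<bar>) \<le> (\<Sum>b\<in>B. \<bar>c i b\<bar>)" for i
    using \<open>finite B\<close> by (intro sum_mono2) auto
  then have "(\<Sum>b\<in>B - {z}. \<bar>c i b\<bar>) \<le> L" if "i \<in> I" for i
    using c(2)[OF that] order_trans by blast
  moreover have "(\<Sum>b\<in>B. c i b * a b j) = (\<Sum>b\<in>B - {z}. c i b * a b j)" for i j
    using \<open>finite B\<close> \<open>a z = _\<close> by (intro sum.mono_neutral_right) auto
  then have "a i = (\<lambda>j. \<Sum>b\<in>B - {z}. c i b * a b j)" if "i \<in> I" for i
    using c(3)[OF that] by simp
  ultimately show ?thesis
    unfolding bounded_spanner_def using c(1) by blast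
qed

lemma bounded_spanner_insert_pivot:
  fixes a :: "'i \<Rightarrow> 'j \<Rightarrow> real"
  assumes "finite B" "pivot \<in> I" "pivot \<notin> B" and l: "\<And>i. i \<in> I \<Longrightarrow> \<bar>l i\<bar> \<le> 1"
    and spanner: "bounded_spanner L (\<lambda>i j. a i j - l i * a pivot j) I B"
  shows "bounded_spanner (2 * L + 1) a I (insert pivot B)"
proof -
  obtain c where "B \<subseteq> I" and c: "\<And>i. i \<in> I \<Longrightarrow> (\<Sum>b\<in>B. \<bar>c i b\<bar>) \<le> L"
    "\<And>i. i \<in> I \<Longrightarrow> (\<lambda>j. a i j - l i * a pivot j) = (\<lambda>j. \<Sum>b\<in>B. c i b * (a b j - l b * a pivot j))"
    using spanner unfolding bounded_spanner_def by blast
  define x where "x i = l i - (\<Sum>b\<in>B. c i b * l b)" for i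
  define c' where "c' i b = (if b = pivot then x i else c i b)" for i b
  have sum_c': "(\<Sum>b\<in>insert pivot B. f (c' i b) b) = f (x i) pivot + (\<Sum>b\<in>B. f (c i b) b)"
    for f :: "real \<Rightarrow> 'i \<Rightarrow> real" and i
  proof -
    have "(\<Sum>b\<in>B. f (c' i b) b) = (\<Sum>b\<in>B. f (c i b) b)"
      using \<open>pivot \<notin> B\<close> by (intro sum.cong) (auto simp: c'_def)
    then show ?thesis using \<open>finite B\<close> \<open>pivot \<notin> B\<close> by (simp add: c'_def)
  qed
  have "a i j = (\<Sum>b\<in>insert pivot B. c' i b * a b j)" if "i \<in> I" for i j
  proof -
    have "a i j - l i * a pivot j = (\<Sum>b\<in>B. c i b * a b j) - (\<Sum>b\<in>B. c i b * l b) * a pivot j"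
      unfolding fun_cong[OF c(2)[OF that]]
      by (simp add: algebra_simps sum_subtractf sum_distrib_left)
    then show ?thesis
      unfolding sum_c'[of "\<lambda>t b. t * a b j"] by (simp add: x_def algebra_simps)
  qed
  moreover have "(\<Sum>b\<in>insert pivot B. \<bar>c' i b\<bar>) \<le> 2 * L + 1" if "i \<in> I" for i
  proof -
    have "\<bar>\<Sum>b\<in>B. c i b * l b\<bar> \<le> (\<Sum>b\<in>B. \<bar>c i b\<bar>)"
      using l \<open>B \<subseteq> I\<close>
      by (intro order_trans[OF sum_abs] sum_mono) (auto simp: abs_mult intro!: mult_left_le)
    then show ?thesis
      unfolding sum_c'[of "\<lambda>t _. \<bar>t\<bar>"] using l[OF that] c(1)[OF that] by (simp add: x_def)
  qed
  ultimately show ?thesis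
    unfolding bounded_spanner_def using \<open>B \<subseteq> I\<close> \<open>pivot \<in> I\<close>
    by (intro conjI exI[of _ c'] ballI ext) auto
qed

lemma exists_max_abs_nonzero:
  fixes f :: "'i \<Rightarrow> real"
  assumes "finite I" "\<exists>i\<in>I. f i \<noteq> 0"
  shows "\<exists>m\<in>I. f m \<noteq> 0 \<and> (\<forall>i\<in>I. \<bar>f i\<bar> \<le> \<bar>f m\<bar>)"
proof -
  have "I \<noteq> {}" using assms(2) by blast
  then obtain m where m: "m \<in> I" "Max ((\<lambda>i. \<bar>f i\<bar>) ` I) = \<bar>f m\<bar>"
    using obtains_MAX[OF \<open>finite I\<close>] by metis
  have le_m: "\<bar>f i\<bar> \<le> \<bar>f m\<bar>" if "i \<in> I" for i
    using that \<open>finite I\<close> by (simp flip: m(2))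
  moreover have "f m \<noteq> 0" using le_m assms(2) by force
  ultimately show ?thesis using m(1) by blast
qed

text \<open>
  Gaussian elimination: subtracting multiples of the vector with the largest entry in one coordinate
  kills that coordinate, and these multiples lie in \<open>[-1, 1]\<close>.
\<close>

lemma bounded_spanner_exists:
  fixes a :: "'i \<Rightarrow> 'j \<Rightarrow> real"
  assumes "finite J" "finite I" "\<And>i j. i \<in> I \<Longrightarrow> j \<notin> J \<Longrightarrow> a i j = 0"
  shows "\<exists>B. card B \<le> card J \<and> bounded_spanner (2 ^ card J - 1) a I B"
  using assms(1,3)
proof (induction J arbitrary: a rule: finite_induct)
  case empty
  then show ?case by (intro exI[of _ "{}"]) (auto simp: bounded_spanner_def)
next
  case (insert k J)
  show ?case
  proof (cases "\<forall>i\<in>I. a i k = 0")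
    case True
    have "a i j = 0" if "i \<in> I" "j \<notin> J" for i j
      using that insert.prems True by (cases "j = k") auto
    then obtain B where "card B \<le> card J" "bounded_spanner (2 ^ card J - 1) a I B"
      using insert.IH[of a] by blast
    then show ?thesis
      using insert.hyps by (intro exI[of _ B]) (auto elim: bounded_spanner_mono)
  next
    case False
    then obtain pivot where pivot: "pivot \<in> I" "a pivot k \<noteq> 0" "\<And>i. i \<in> I \<Longrightarrow> \<bar>a i k\<bar> \<le> \<bar>a pivot k\<bar>"
      using exists_max_abs_nonzero[OF \<open>finite I\<close>, of "\<lambda>i. a i k"] by blast
    define l where "l i = a i k / a pivot k" for i
    define a' where "a' i j = a i j - l i * a pivot j" for i j
    have "a' i j = 0" if "i \<in> I" "j \<notin> J" for i j
      using that insert.prems pivot(1,2) by (cases "j = k") (auto simp: a'_def l_def)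
    then obtain B where B: "card B \<le> card J" "bounded_spanner (2 ^ card J - 1) a' I B"
      using insert.IH[of a'] by blast
    have "finite B" using B(2) \<open>finite I\<close> by (auto simp: bounded_spanner_def finite_subset)
    have "\<bar>l i\<bar> \<le> 1" if "i \<in> I" for i
      using pivot(3)[OF that] by (auto simp: l_def divide_le_eq_1)
    moreover have "bounded_spanner (2 ^ card J - 1) a' I (B - {pivot})"
      using B(2) \<open>finite B\<close> pivot(2)
      by (intro bounded_spanner_remove_zero) (auto simp: a'_def l_def)
    ultimately have "bounded_spanner (2 * (2 ^ card J - 1) + 1) a I (insert pivot (B - {pivot}))"
      using \<open>finite B\<close> pivot(1)
      by (intro bounded_spanner_insert_pivot[where l = l]) (auto simp: a'_def[abs_def])
    moreover have "card (insert pivot B) \<le> card (insert k J)"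
      using B(1) insert.hyps card_insert_le_m1[of "Suc (card J)" B pivot] by simp
    ultimately show ?thesis
      using insert.hyps by (intro exI[of _ "insert pivot B"]) simp
  qed
qed

lemma card_floor_interval_le:
  fixes x :: real
  assumes "0 \<le> x"
  shows "real (card {\<lfloor>- x\<rfloor>..\<lfloor>x\<rfloor>}) \<le> 2 * x + 2"
  using assms by simp linarith

lemma card_separated_box_points_le:
  fixes c :: "'i \<Rightarrow> 'b \<Rightarrow> real"
  assumes "finite B" "0 < \<delta>"
    and bound: "\<And>i b. i \<in> I \<Longrightarrow> b \<in> B \<Longrightarrow> \<bar>c i b\<bar> \<le> L"
    and sep: "\<And>i i'. i \<in> I \<Longrightarrow> i' \<in> I \<Longrightarrow> i \<noteq> i' \<Longrightarrow> \<exists>b\<in>B. \<delta> \<le> \<bar>c i b - c i' b\<bar>"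
    and "0 \<le> L"
  shows "real (card I) \<le> (2 * (L / \<delta>) + 2) ^ card B"
proof -
  define cell where "cell i = (\<lambda>b\<in>B. \<lfloor>c i b / \<delta>\<rfloor>)" for i
  let ?K = "{\<lfloor>- (L / \<delta>)\<rfloor>..\<lfloor>L / \<delta>\<rfloor>}"
  have "inj_on cell I"
  proof (rule inj_onI, rule ccontr)
    fix i i' assume *: "i \<in> I" "i' \<in> I" "cell i = cell i'" "i \<noteq> i'"
    then obtain b where b: "b \<in> B" "\<delta> \<le> \<bar>c i b - c i' b\<bar>" using sep by blast
    have "\<lfloor>c i b / \<delta>\<rfloor> = \<lfloor>c i' b / \<delta>\<rfloor>"
      using *(3) b(1) by (metis cell_def restrict_apply')
    then have "\<bar>c i b / \<delta> - c i' b / \<delta>\<bar> < 1" by linarith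
    then show False
      using b(2) \<open>0 < \<delta>\<close> by (simp flip: diff_divide_distrib add: abs_divide)
  qed
  moreover have "cell ` I \<subseteq> (\<Pi>\<^sub>E b\<in>B. ?K)"
  proof (safe intro!: PiE_I)
    fix i b assume "i \<in> I" "b \<in> B"
    then have "- (L / \<delta>) \<le> c i b / \<delta>" "c i b / \<delta> \<le> L / \<delta>"
      using bound[of i b] \<open>0 < \<delta>\<close> by (simp_all add: field_simps abs_le_iff)
    then show "cell i b \<in> ?K"
      using \<open>b \<in> B\<close> by (simp add: cell_def floor_mono)
  qed (simp add: cell_def)
  ultimately have "card I \<le> card (\<Pi>\<^sub>E b\<in>B. ?K)"
    using \<open>finite B\<close> by (intro card_inj_on_le finite_PiE) auto
  also have "\<dots> = card ?K ^ card B"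
    using \<open>finite B\<close> by (simp add: card_PiE)
  finally have "real (card I) \<le> real (card ?K) ^ card B"
    by (metis of_nat_le_iff of_nat_power)
  also have "\<dots> \<le> (2 * (L / \<delta>) + 2) ^ card B"
    using \<open>0 \<le> L\<close> \<open>0 < \<delta>\<close> by (intro power_mono card_floor_interval_le) auto
  finally show ?thesis .
qed

lemma seminorm_separated_coefficients:
  fixes p :: "('j \<Rightarrow> real) \<Rightarrow> real" and \<delta> R :: real
  assumes p: "seminorm p" and "0 \<le> \<delta>" and bound: "\<And>b. b \<in> B \<Longrightarrow> p (a b) \<le> R"
    and far: "card B * (\<delta> * R) < p (\<lambda>j. (\<Sum>b\<in>B. c b * a b j) - (\<Sum>b\<in>B. c' b * a b j))"
  shows "\<exists>b\<in>B. \<delta> < \<bar>c b - c' b\<bar>"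
proof (rule ccontr)
  assume "\<not> ?thesis"
  then have close: "\<bar>c b - c' b\<bar> \<le> \<delta>" if "b \<in> B" for b using that by force
  have "p (\<lambda>j. (\<Sum>b\<in>B. c b * a b j) - (\<Sum>b\<in>B. c' b * a b j)) = p (\<lambda>j. \<Sum>b\<in>B. (c b - c' b) * a b j)"
    by (simp add: left_diff_distrib sum_subtractf)
  also have "\<dots> \<le> (\<Sum>b\<in>B. \<bar>c b - c' b\<bar> * p (a b))"
    by (rule seminorm_linear_combination[OF p])
  also have "\<dots> \<le> (\<Sum>b\<in>B. \<delta> * R)"
    using close bound \<open>0 \<le> \<delta>\<close> seminorm_nonneg[OF p] by (intro sum_mono mult_mono) auto
  finally show False using far by simp
qed

lemma grid_size_le:
  fixes \<rho> :: real
  assumes "1 \<le> 2 * \<rho>"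
  shows "2 * ((2 ^ n - 1) * (2 ^ n * \<rho>)) + 2 \<le> 4 ^ Suc n * \<rho>"
proof -
  have "1 * 1 \<le> 2 ^ n * (2 * \<rho>)" "1 * 1 \<le> 4 ^ n * (2 * \<rho>)"
    using assms by (intro mult_mono; simp)+
  moreover have "(2 ^ n - 1) * (2 ^ n * \<rho>) = 4 ^ n * \<rho> - 2 ^ n * \<rho>"
    by (simp add: left_diff_distrib flip: power_mult_distrib mult.assoc)
  ultimately show ?thesis by (simp add: mult_ac)
qed

text \<open>
  The volumetric bound \<open>(1 + 2 * R / r) ^ card J\<close> is stronger; a spanner avoids measuring volumes.
\<close>

lemma seminorm_packing:
  fixes p :: "('j \<Rightarrow> real) \<Rightarrow> real" and a :: "'i \<Rightarrow> 'j \<Rightarrow> real"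
  assumes p: "seminorm p" and "finite J" "finite I"
    and supp: "\<And>i j. i \<in> I \<Longrightarrow> j \<notin> J \<Longrightarrow> a i j = 0"
    and bound: "\<And>i. i \<in> I \<Longrightarrow> p (a i) \<le> R"
    and sep: "\<And>i i'. i \<in> I \<Longrightarrow> i' \<in> I \<Longrightarrow> i \<noteq> i' \<Longrightarrow> r \<le> p (\<lambda>j. a i j - a i' j)"
    and r: "0 < r" "r \<le> 2 * R"
  shows "real (card I) \<le> (4 ^ Suc (card J) * (R / r)) ^ card J"
proof -
  define n where "n = card J"
  define \<delta> where "\<delta> = 1 / (2 ^ n * (R / r))"
  have ratio: "1 \<le> 2 * (R / r)" "0 < R / r" using r by (simp_all add: field_simps)
  then have \<delta>: "0 < \<delta>" "\<delta> * R = r / 2 ^ n" using r by (simp_all add: \<delta>_def)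
  obtain B where "card B \<le> n" and "bounded_spanner (2 ^ n - 1) a I B"
    using bounded_spanner_exists[where a = a and I = I, OF \<open>finite J\<close> \<open>finite I\<close> supp]
    unfolding n_def by blast
  then obtain c where "B \<subseteq> I" and c: "\<And>i. i \<in> I \<Longrightarrow> (\<Sum>b\<in>B. \<bar>c i b\<bar>) \<le> 2 ^ n - 1"
    "\<And>i. i \<in> I \<Longrightarrow> a i = (\<lambda>j. \<Sum>b\<in>B. c i b * a b j)"
    unfolding bounded_spanner_def by blast
  have "finite B" using \<open>B \<subseteq> I\<close> \<open>finite I\<close> by (rule finite_subset)
  have "card B * (\<delta> * R) \<le> real n * (r / 2 ^ n)"
    unfolding \<delta>(2) using \<open>card B \<le> n\<close> r by (intro mult_right_mono) auto
  also have "\<dots> < 2 ^ n * (r / 2 ^ n)"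
    using r by (intro mult_strict_right_mono of_nat_less_two_power) simp
  finally have "card B * (\<delta> * R) < r" by simp
  then have "\<exists>b\<in>B. \<delta> < \<bar>c i b - c i' b\<bar>" if i: "i \<in> I" "i' \<in> I" "i \<noteq> i'" for i i'
    using \<delta>(1) \<open>B \<subseteq> I\<close> bound sep[OF i] unfolding c(2)[OF i(1)] c(2)[OF i(2)]
    by (intro seminorm_separated_coefficients[OF p, of \<delta> B a R]) auto
  then have "\<exists>b\<in>B. \<delta> \<le> \<bar>c i b - c i' b\<bar>" if "i \<in> I" "i' \<in> I" "i \<noteq> i'" for i i'
    using that less_imp_le by metis
  moreover have "\<bar>c i b\<bar> \<le> 2 ^ n - 1" if "i \<in> I" "b \<in> B" for i b
    using member_le_sum[OF that(2), of "\<lambda>b. \<bar>c i b\<bar>"] c(1)[OF that(1)] \<open>finite B\<close> by simp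
  ultimately have "real (card I) \<le> (2 * ((2 ^ n - 1) / \<delta>) + 2) ^ card B"
    using \<open>finite B\<close> \<delta>(1) by (intro card_separated_box_points_le) auto
  also have "\<dots> \<le> (2 * ((2 ^ n - 1) / \<delta>) + 2) ^ n"
    using \<open>card B \<le> n\<close> \<delta>(1) by (intro power_increasing) auto
  also have "\<dots> \<le> (4 ^ Suc n * (R / r)) ^ n"
  proof (rule power_mono)
    show "2 * ((2 ^ n - 1) / \<delta>) + 2 \<le> 4 ^ Suc n * (R / r)"
      using grid_size_le[OF ratio(1), of n] by (simp add: \<delta>_def)
  qed (use \<delta>(1) in simp)
  finally show ?thesis unfolding n_def .
qed

subsection \<open>Linear maps as matrices\<close>

definition basis_vec :: "nat \<Rightarrow> nat \<Rightarrow> real" where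
  "basis_vec k i = (if i = k then 1 else 0)"

lemma basis_vec_in_Rn: "k < n \<Longrightarrow> basis_vec k \<in> Rn n"
  by (simp add: basis_vec_def topspace_Euclidean_space)

lemma lin_map_eq_sum_basis_vec:
  assumes f: "f \<in> lin_maps m n" and x: "x \<in> Rn m"
  shows "f x i = (\<Sum>k<m. f (basis_vec k) i * x k)"
proof -
  have truncated: "f (\<lambda>i. if i < l then x i else 0) = (\<lambda>i. \<Sum>k<l. f (basis_vec k) i * x k)"
    if "l \<le> m" for l
    using that
  proof (induction l)
    case 0
    have "f (\<lambda>i. 0 * x i) = (\<lambda>i. 0 * f x i)" using f x unfolding lin_maps_def by blast
    then show ?case by simp
  next
    case (Suc l)
    let ?y = "\<lambda>i. if i < l then x i else 0"
    have "f (\<lambda>i. if i < Suc l then x i else 0) = f (\<lambda>i. ?y i + x l * basis_vec l i)"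
      by (rule arg_cong[where f = f]) (auto simp: basis_vec_def fun_eq_iff less_Suc_eq)
    also have "\<dots> = (\<lambda>i. f ?y i + f (\<lambda>i. x l * basis_vec l i) i)"
      using f Suc.prems by (simp add: lin_maps_def topspace_Euclidean_space basis_vec_def)
    also have "f (\<lambda>i. x l * basis_vec l i) = (\<lambda>i. x l * f (basis_vec l) i)"
      using f basis_vec_in_Rn[of l m] Suc.prems by (simp add: lin_maps_def)
    finally show ?case
      using Suc by (simp add: mult.commute)
  qed
  have "(\<lambda>i. if i < m then x i else 0) = x"
    using x by (auto simp: topspace_Euclidean_space fun_eq_iff)
  then show ?thesis using truncated[OF order_refl] by simp
qed

definition matrix_apply :: "nat \<Rightarrow> nat \<Rightarrow> (nat \<times> nat \<Rightarrow> real) \<Rightarrow> (nat \<Rightarrow> real) \<Rightarrow> nat \<Rightarrow> real" where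
  "matrix_apply m n a x i = (if i < n then \<Sum>k<m. a (i, k) * x k else 0)"

definition matrix_of :: "nat \<Rightarrow> nat \<Rightarrow> ((nat \<Rightarrow> real) \<Rightarrow> nat \<Rightarrow> real) \<Rightarrow> nat \<times> nat \<Rightarrow> real" where
  "matrix_of m n f = (\<lambda>(i, k). if i < n \<and> k < m then f (basis_vec k) i else 0)"

lemma matrix_of_eq_0: "j \<notin> {..<n} \<times> {..<m} \<Longrightarrow> matrix_of m n f j = 0"
  by (auto simp: matrix_of_def split: prod.splits)

lemma matrix_apply_matrix_of:
  assumes f: "f \<in> lin_maps m n" and x: "x \<in> Rn m"
  shows "matrix_apply m n (matrix_of m n f) x = f x"
proof
  fix i
  have "f x \<in> Rn n" using f x by (auto simp: lin_maps_def)
  then show "matrix_apply m n (matrix_of m n f) x i = f x i"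
    using lin_map_eq_sum_basis_vec[OF f x, of i]
    by (cases "i < n") (simp_all add: matrix_apply_def matrix_of_def topspace_Euclidean_space)
qed

lemma seminorm_matrix_apply:
  assumes N: "norm_on n N"
  shows "seminorm (\<lambda>a. N (matrix_apply m n a x))"
proof (rule seminormI)
  have in_Rn: "matrix_apply m n a x \<in> Rn n" for a
    by (simp add: matrix_apply_def topspace_Euclidean_space)
  show "N (matrix_apply m n (\<lambda>j. c * a j) x) = \<bar>c\<bar> * N (matrix_apply m n a x)" for c a
  proof -
    have "matrix_apply m n (\<lambda>j. c * a j) x = (\<lambda>i. c * matrix_apply m n a x i)"
      by (auto simp: matrix_apply_def sum_distrib_left mult.assoc)
    then show ?thesis using N in_Rn by (simp add: norm_on_def)
  qed
  show "N (matrix_apply m n (\<lambda>j. a j + b j) x)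
      \<le> N (matrix_apply m n a x) + N (matrix_apply m n b x)" for a b
  proof -
    have "matrix_apply m n (\<lambda>j. a j + b j) x
        = (\<lambda>i. matrix_apply m n a x i + matrix_apply m n b x i)"
      by (auto simp: matrix_apply_def sum.distrib distrib_right)
    then show ?thesis using N in_Rn by (simp add: norm_on_def)
  qed
qed

lemma lin_maps_packing:
  fixes F :: "'i \<Rightarrow> (nat \<Rightarrow> real) \<Rightarrow> nat \<Rightarrow> real"
  assumes N: "norm_on n N" and "finite I" "finite S" "S \<subseteq> Rn m"
    and F: "\<And>i. i \<in> I \<Longrightarrow> F i \<in> lin_maps m n"
    and bound: "\<And>i u. i \<in> I \<Longrightarrow> u \<in> S \<Longrightarrow> N (F i u) \<le> R"
    and sep: "\<And>i i'. i \<in> I \<Longrightarrow> i' \<in> I \<Longrightarrow> i \<noteq> i' \<Longrightarrow> \<exists>u\<in>S. r \<le> \<bar>N (F i u) - N (F i' u)\<bar>"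
    and r: "0 < r" "r \<le> 2 * R"
  shows "real (card I) \<le> (4 ^ Suc (n * m) * (R / r)) ^ (n * m)"
proof -
  define a where "a i = matrix_of m n (F i)" for i
  define q where "q u b = N (matrix_apply m n b u)" for u b
  define p where "p b = Max (insert 0 ((\<lambda>u. q u b) ` S))" for b
  have q_a: "q u (a i) = N (F i u)" if "i \<in> I" "u \<in> S" for i u
    using that F \<open>S \<subseteq> Rn m\<close> by (auto simp: q_def a_def matrix_apply_matrix_of)
  have q: "seminorm (q u)" for u
    unfolding q_def by (rule seminorm_matrix_apply[OF N])
  have "real (card I) \<le> (4 ^ Suc (card ({..<n} \<times> {..<m})) * (R / r)) ^ card ({..<n} \<times> {..<m})"
  proof (rule seminorm_packing[where p = p and a = a])
    show "seminorm p"
      unfolding p_def using q \<open>finite S\<close> by (intro seminorm_Max) (auto simp: seminorm_def)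
    show "p (a i) \<le> R" if "i \<in> I" for i
      using that r q_a bound \<open>finite S\<close> by (simp add: p_def)
    show "r \<le> p (\<lambda>j. a i j - a i' j)" if i: "i \<in> I" "i' \<in> I" "i \<noteq> i'" for i i'
    proof -
      obtain u where "u \<in> S" and "r \<le> \<bar>q u (a i) - q u (a i')\<bar>"
        using sep[OF i] q_a i by auto
      note this(2)
      also have "\<dots> \<le> q u (\<lambda>j. a i j - a i' j)" by (rule seminorm_abs_diff_le[OF q])
      also have "\<dots> \<le> p (\<lambda>j. a i j - a i' j)" using \<open>u \<in> S\<close> \<open>finite S\<close> by (simp add: p_def)
      finally show ?thesis .
    qed
  qed (use \<open>finite I\<close> r in \<open>auto simp: a_def matrix_of_eq_0\<close>)
  then show ?thesis by (simp add: card_cartesian_product)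
qed

lemma card_traces_le:
  assumes N: "norm_on n N" and "finite \<T>" "finite S" "S \<subseteq> Rn m"
    and F: "\<And>T. T \<in> \<T> \<Longrightarrow> F T \<in> lin_maps m n"
    and bound: "\<And>T u. T \<in> \<T> \<Longrightarrow> u \<in> S \<Longrightarrow> N (F T u) \<le> R"
    and inside: "\<And>T u. T \<in> \<T> \<Longrightarrow> u \<in> S \<Longrightarrow> u \<in> T \<Longrightarrow> s + r \<le> N (F T u)"
    and outside: "\<And>T u. T \<in> \<T> \<Longrightarrow> u \<in> S \<Longrightarrow> u \<notin> T \<Longrightarrow> N (F T u) \<le> s"
    and r: "0 < r" "r \<le> 2 * R"
  shows "real (card ((\<lambda>T. T \<inter> S) ` \<T>)) \<le> (4 ^ Suc (n * m) * (R / r)) ^ (n * m)"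
proof -
  have "\<exists>\<R>\<subseteq>\<T>. inj_on (\<lambda>T. T \<inter> S) \<R> \<and> (\<lambda>T. T \<inter> S) ` \<T> = (\<lambda>T. T \<inter> S) ` \<R>"
    by (rule subset_image_inj[THEN iffD1]) simp
  then obtain \<R> where \<R>: "\<R> \<subseteq> \<T>" "inj_on (\<lambda>T. T \<inter> S) \<R>"
    "(\<lambda>T. T \<inter> S) ` \<T> = (\<lambda>T. T \<inter> S) ` \<R>"
    by blast
  have "\<exists>u\<in>S. r \<le> \<bar>N (F T u) - N (F T' u)\<bar>" if T: "T \<in> \<R>" "T' \<in> \<R>" "T \<noteq> T'" for T T'
  proof -
    obtain u where u: "u \<in> S" "u \<in> T \<and> u \<notin> T' \<or> u \<in> T' \<and> u \<notin> T"
      using inj_onD[OF \<R>(2) _ T(1,2)] T(3) by blast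
    have "s + r \<le> N (F T u) \<and> N (F T' u) \<le> s \<or> s + r \<le> N (F T' u) \<and> N (F T u) \<le> s"
      using u \<R>(1) T(1,2) inside outside by blast
    then show ?thesis using u(1) by (intro bexI[of _ u]) auto
  qed
  then have "real (card \<R>) \<le> (4 ^ Suc (n * m) * (R / r)) ^ (n * m)"
    using \<R>(1) F bound r \<open>finite \<T>\<close> \<open>finite S\<close> \<open>S \<subseteq> Rn m\<close>
    by (intro lin_maps_packing[OF N, where S = S and F = F]) (auto intro: finite_subset)
  then show ?thesis by (simp add: \<R>(2,3) card_image)
qed

subsection \<open>Almost orthogonal sign vectors\<close>

lemma map_pmf_card_pmf_of_set_Pow:
  assumes "finite X"
  shows "map_pmf card (pmf_of_set (Pow X)) = binomial_pmf (card X) (1 / 2)"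
proof (rule pmf_eqI)
  fix k
  have "pmf (map_pmf card (pmf_of_set (Pow X))) k
      = real (card {B. B \<subseteq> X \<and> card B = k}) / 2 ^ card X"
    using assms
    by (simp add: pmf_map measure_pmf_of_set card_Pow Pow_not_empty vimage_def Int_def)
  also have "\<dots> = real (card X choose k) * (1 / 2) ^ card X"
    by (simp add: n_subsets[OF assms] power_one_over)
  also have "\<dots> = pmf (binomial_pmf (card X) (1 / 2)) k"
    by (cases "k \<le> card X") (simp_all flip: power_add)
  finally show "pmf (map_pmf card (pmf_of_set (Pow X))) k = pmf (binomial_pmf (card X) (1 / 2)) k" .
qed

lemma card_unbalanced_subsets_le:
  assumes "finite X" "X \<noteq> {}" "0 \<le> t"
  shows "real (card {B \<in> Pow X. t \<le> \<bar>card B - card X / 2\<bar>})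
    \<le> 2 ^ card X * (2 * exp (- 2 * t\<^sup>2 / card X))"
proof -
  interpret binomial_distribution "card X" "1 / 2" by unfold_locales simp
  have "real (card {B \<in> Pow X. t \<le> \<bar>card B - card X / 2\<bar>}) / 2 ^ card X
      = measure_pmf.prob (map_pmf card (pmf_of_set (Pow X))) {k. t \<le> \<bar>k - card X / 2\<bar>}"
    using assms by (simp add: measure_pmf_of_set card_Pow Pow_not_empty Int_def)
  also have "\<dots> \<le> 2 * exp (- 2 * t\<^sup>2 / card X)"
    using prob_abs_ge[OF _ \<open>0 \<le> t\<close>] assms
    by (simp add: map_pmf_card_pmf_of_set_Pow card_gt_0_iff)
  finally show ?thesis by (simp add: field_simps)
qed

definition dot :: "nat \<Rightarrow> (nat \<Rightarrow> real) \<Rightarrow> (nat \<Rightarrow> real) \<Rightarrow> real" where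
  "dot d x y = (\<Sum>i<d. x i * y i)"

definition sign_vec :: "nat \<Rightarrow> nat set \<Rightarrow> nat \<Rightarrow> real" where
  "sign_vec d A i = (if i < d then if i \<in> A then 1 else - 1 else 0)"

definition sign_vecs :: "nat \<Rightarrow> (nat \<Rightarrow> real) set" where
  "sign_vecs d = sign_vec d ` Pow {..<d}"

lemma sign_vecs_in_Rn: "u \<in> sign_vecs d \<Longrightarrow> u \<in> Rn d"
  by (auto simp: sign_vecs_def sign_vec_def topspace_Euclidean_space)

lemma sum_abs_sign_vec: "u \<in> sign_vecs d \<Longrightarrow> (\<Sum>i<d. \<bar>u i\<bar>) = d"
  by (auto simp: sign_vecs_def sign_vec_def if_distrib[of abs] cong: if_cong)

lemma finite_sign_vecs: "finite (sign_vecs d)"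
  by (simp add: sign_vecs_def)

lemma card_sign_vecs: "card (sign_vecs d) = 2 ^ d"
proof -
  have "inj_on (sign_vec d) (Pow {..<d})"
  proof (rule inj_onI)
    fix A B assume "A \<in> Pow {..<d}" "B \<in> Pow {..<d}" "sign_vec d A = sign_vec d B"
    moreover have "A = {i. sign_vec d A i = 1}" if "A \<in> Pow {..<d}" for A
      using that by (auto simp: sign_vec_def split: if_splits)
    ultimately show "A = B" by metis
  qed
  then show ?thesis by (simp add: sign_vecs_def card_image card_Pow)
qed

lemma dot_sign_vec:
  assumes "A \<subseteq> {..<d}" "B \<subseteq> {..<d}"
  shows "dot d (sign_vec d A) (sign_vec d B) = real d - 2 * real (card (sym_diff A B))"
proof -
  have indicator: "(\<Sum>i<d. if i \<in> D then 1 else 0) = real (card ({..<d} \<inter> D))" for D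
    by (simp add: sum.If_cases)
  have "dot d (sign_vec d A) (sign_vec d B) = (\<Sum>i<d. 1 - 2 * (if i \<in> sym_diff A B then 1 else 0))"
    unfolding dot_def by (intro sum.cong) (auto simp: sign_vec_def)
  also have "\<dots> = real d - 2 * real (card ({..<d} \<inter> sym_diff A B))"
    by (simp only: sum_subtractf sum_distrib_left[symmetric] indicator) simp
  also have "{..<d} \<inter> sym_diff A B = sym_diff A B" using assms by auto
  finally show ?thesis .
qed

lemma dot_sign_vec_self: "u \<in> sign_vecs d \<Longrightarrow> dot d u u = d"
  by (auto simp: sign_vecs_def dot_sign_vec)

lemma card_correlated_sign_vecs_le:
  assumes "0 < d" "0 \<le> \<gamma>" "u \<in> sign_vecs d"
  shows "real (card {v \<in> sign_vecs d. \<gamma> * d \<le> \<bar>dot d u v\<bar>}) \<le> 2 ^ d * (2 * exp (- (\<gamma>\<^sup>2 * d / 2)))"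
proof -
  obtain A where A: "A \<subseteq> {..<d}" "u = sign_vec d A" using assms(3) by (auto simp: sign_vecs_def)
  let ?C = "{C \<in> Pow {..<d}. \<gamma> * d / 2 \<le> \<bar>card C - d / 2\<bar>}"
  have "{v \<in> sign_vecs d. \<gamma> * d \<le> \<bar>dot d u v\<bar>} \<subseteq> (\<lambda>C. sign_vec d (sym_diff A C)) ` ?C"
  proof
    fix v assume "v \<in> {v \<in> sign_vecs d. \<gamma> * d \<le> \<bar>dot d u v\<bar>}"
    then obtain B where B: "B \<subseteq> {..<d}" "v = sign_vec d B" "\<gamma> * d \<le> \<bar>dot d u v\<bar>"
      by (auto simp: sign_vecs_def)
    then have "dot d u v = real d - 2 * real (card (sym_diff A B))"
      using A by (simp add: dot_sign_vec)
    then have "\<gamma> * d / 2 \<le> \<bar>real (card (sym_diff A B)) - d / 2\<bar>"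
      using B(3) by linarith
    then have "sym_diff A B \<in> ?C"
      using A(1) B(1) by auto
    moreover have "v = sign_vec d (sym_diff A (sym_diff A B))"
      unfolding B(2) by (rule arg_cong[where f = "sign_vec d"]) blast
    ultimately show "v \<in> (\<lambda>C. sign_vec d (sym_diff A C)) ` ?C" by blast
  qed
  then have "card {v \<in> sign_vecs d. \<gamma> * d \<le> \<bar>dot d u v\<bar>} \<le> card ?C"
    by (rule surj_card_le[rotated]) simp
  also have "real (card ?C) \<le> 2 ^ d * (2 * exp (- 2 * (\<gamma> * d / 2)\<^sup>2 / d))"
    using card_unbalanced_subsets_le[of "{..<d}" "\<gamma> * d / 2"] assms(1,2) by auto
  also have "- 2 * (\<gamma> * d / 2)\<^sup>2 / d = - (\<gamma>\<^sup>2 * d / 2)"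
    using \<open>0 < d\<close> by (simp add: power2_eq_square field_simps)
  finally show ?thesis by simp
qed

lemma exists_large_conflict_free_subset:
  assumes "finite V" and refl: "\<And>x. x \<in> V \<Longrightarrow> R x x" and sym: "\<And>x y. R x y \<Longrightarrow> R y x"
    and degree: "\<And>x. x \<in> V \<Longrightarrow> real (card {y \<in> V. R x y}) \<le> k"
  shows "\<exists>W\<subseteq>V. pairwise (\<lambda>x y. \<not> R x y) W \<and> real (card V) \<le> real (card W) * k"
proof -
  let ?\<C> = "{W. W \<subseteq> V \<and> pairwise (\<lambda>x y. \<not> R x y) W}"
  have "finite ?\<C>" "{} \<in> ?\<C>" using \<open>finite V\<close> by auto
  then have "\<exists>W\<in>?\<C>. \<forall>W'\<in>?\<C>. W \<subseteq> W' \<longrightarrow> W = W'"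
    by (intro finite_has_maximal) auto
  then obtain W where W: "W \<in> ?\<C>" and maximal: "\<forall>W'\<in>?\<C>. W \<subseteq> W' \<longrightarrow> W = W'" ..
  have "finite W" using W \<open>finite V\<close> finite_subset by blast
  have "V \<subseteq> (\<Union>x\<in>W. {y \<in> V. R x y})"
  proof
    fix y assume "y \<in> V"
    show "y \<in> (\<Union>x\<in>W. {y \<in> V. R x y})"
    proof (cases "y \<in> W")
      case True
      then show ?thesis using \<open>y \<in> V\<close> refl by blast
    next
      case False
      then have "insert y W \<notin> ?\<C>" using maximal by blast
      then show ?thesis using W \<open>y \<in> V\<close> sym by (auto simp: pairwise_insert)
    qed
  qed
  then have "card V \<le> card (\<Union>x\<in>W. {y \<in> V. R x y})"
    using \<open>finite V\<close> \<open>finite W\<close> by (intro card_mono) auto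
  also have "\<dots> \<le> (\<Sum>x\<in>W. card {y \<in> V. R x y})" by (rule card_UN_le[OF \<open>finite W\<close>])
  finally have "real (card V) \<le> (\<Sum>x\<in>W. real (card {y \<in> V. R x y}))"
    by (simp flip: of_nat_sum)
  also have "\<dots> \<le> real (card W) * k"
    using W degree by (intro sum_bounded_above) auto
  finally show ?thesis using W by (intro exI[of _ W]) simp
qed

definition almost_orthogonal :: "nat \<Rightarrow> real \<Rightarrow> (nat \<Rightarrow> real) set \<Rightarrow> bool" where
  "almost_orthogonal d \<gamma> W \<longleftrightarrow> pairwise (\<lambda>u v. \<bar>dot d u v\<bar> \<le> \<gamma> * d) W"

lemma almost_orthogonalD:
  "almost_orthogonal d \<gamma> W \<Longrightarrow> u \<in> W \<Longrightarrow> v \<in> W \<Longrightarrow> u \<noteq> v \<Longrightarrow> \<bar>dot d u v\<bar> \<le> \<gamma> * d"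
  by (auto simp: almost_orthogonal_def pairwise_def)

lemma exists_large_almost_orthogonal_sign_vecs:
  assumes "0 < d" "0 \<le> \<gamma>" "\<gamma> \<le> 1"
  obtains W where "W \<subseteq> sign_vecs d" "almost_orthogonal d \<gamma> W"
    "exp (\<gamma>\<^sup>2 * d / 2) \<le> 2 * real (card W)"
proof -
  have "\<exists>W\<subseteq>sign_vecs d. pairwise (\<lambda>u v. \<not> \<gamma> * d \<le> \<bar>dot d u v\<bar>) W
    \<and> real (card (sign_vecs d)) \<le> real (card W) * (2 ^ d * (2 * exp (- (\<gamma>\<^sup>2 * d / 2))))"
  proof (rule exists_large_conflict_free_subset[OF finite_sign_vecs])
    show "\<gamma> * d \<le> \<bar>dot d u u\<bar>" if "u \<in> sign_vecs d" for u
      using that assms by (simp add: dot_sign_vec_self mult_left_le_one_le)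
    show "\<gamma> * d \<le> \<bar>dot d v u\<bar>" if "\<gamma> * d \<le> \<bar>dot d u v\<bar>" for u v
      using that by (simp add: dot_def mult.commute)
  qed (use assms card_correlated_sign_vecs_le in auto)
  then obtain W where W: "W \<subseteq> sign_vecs d" "pairwise (\<lambda>u v. \<not> \<gamma> * d \<le> \<bar>dot d u v\<bar>) W"
    "real (card (sign_vecs d)) \<le> real (card W) * (2 ^ d * (2 * exp (- (\<gamma>\<^sup>2 * d / 2))))"
    by blast
  show thesis
  proof (rule that[OF W(1)])
    show "almost_orthogonal d \<gamma> W"
      using W(2) unfolding almost_orthogonal_def by (rule pairwise_mono) auto
    show "exp (\<gamma>\<^sup>2 * d / 2) \<le> 2 * real (card W)"
      using W(3) by (simp add: card_sign_vecs exp_minus field_simps)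
  qed
qed

subsection \<open>Test norms\<close>

definition test_norm :: "nat \<Rightarrow> real \<Rightarrow> (nat \<Rightarrow> real) set \<Rightarrow> (nat \<Rightarrow> real) \<Rightarrow> real" where
  "test_norm d \<gamma> T x = Max (insert (\<gamma> * (\<Sum>i<d. \<bar>x i\<bar>)) ((\<lambda>t. \<bar>dot d x t\<bar>) ` T))"

lemma seminorm_l1:
  assumes "0 \<le> \<gamma>"
  shows "seminorm (\<lambda>x. \<gamma> * (\<Sum>i<d. \<bar>x i\<bar>))"
proof (rule seminormI)
  show "\<gamma> * (\<Sum>i<d. \<bar>x i + y i\<bar>) \<le> \<gamma> * (\<Sum>i<d. \<bar>x i\<bar>) + \<gamma> * (\<Sum>i<d. \<bar>y i\<bar>)" for x y
    using assms by (auto intro!: mult_left_mono sum_mono simp flip: distrib_left sum.distrib)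
qed (simp add: abs_mult mult.left_commute flip: sum_distrib_left)

lemma seminorm_abs_dot: "seminorm (\<lambda>x. \<bar>dot d x t\<bar>)"
proof (rule seminormI)
  show "\<bar>dot d (\<lambda>i. c * x i) t\<bar> = \<bar>c\<bar> * \<bar>dot d x t\<bar>" for c x
    by (simp add: dot_def mult.assoc abs_mult flip: sum_distrib_left)
  show "\<bar>dot d (\<lambda>i. x i + y i) t\<bar> \<le> \<bar>dot d x t\<bar> + \<bar>dot d y t\<bar>" for x y
    by (simp add: dot_def distrib_right sum.distrib)
qed

lemma norm_on_test_norm:
  assumes "finite T" "0 < \<gamma>"
  shows "norm_on d (test_norm d \<gamma> T)"
proof -
  have N: "seminorm (test_norm d \<gamma> T)"
    unfolding test_norm_def[abs_def]
    using assms by (intro seminorm_Max seminorm_l1 seminorm_abs_dot) auto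
  have "x = (\<lambda>_. 0)" if "x \<in> Rn d" "test_norm d \<gamma> T x = 0" for x
  proof -
    have "\<gamma> * (\<Sum>i<d. \<bar>x i\<bar>) \<le> 0"
      using that(2) assms(1) by (metis Max_ge finite_imageI finite_insert insertI1 test_norm_def)
    then have "(\<Sum>i<d. \<bar>x i\<bar>) = 0"
      using \<open>0 < \<gamma>\<close> by (intro antisym sum_nonneg) (auto simp: mult_le_0_iff)
    then have "x i = 0" if "i < d" for i using that by (simp add: sum_nonneg_eq_0_iff)
    then show ?thesis
      using that(1) by (auto simp: topspace_Euclidean_space) (metis not_less)
  qed
  then show ?thesis
    using N seminorm_zero[OF N] seminorm_nonneg[OF N] by (auto simp: norm_on_def seminorm_def)
qed

lemma test_norm_outside:
  assumes "W \<subseteq> sign_vecs d" "almost_orthogonal d \<gamma> W" "T \<subseteq> W" "u \<in> W - T"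
  shows "test_norm d \<gamma> T u = \<gamma> * d"
proof -
  have "finite T" using assms(1,3) finite_sign_vecs finite_subset by metis
  moreover have "\<bar>dot d u t\<bar> \<le> \<gamma> * d" if "t \<in> T" for t
    using assms(3,4) that by (intro almost_orthogonalD[OF assms(2)]) auto
  moreover have "(\<Sum>i<d. \<bar>u i\<bar>) = d"
    using assms(1,4) sum_abs_sign_vec by blast
  ultimately show ?thesis
    unfolding test_norm_def by (intro Max_eqI) auto
qed

lemma test_norm_inside:
  assumes "W \<subseteq> sign_vecs d" "almost_orthogonal d \<gamma> W" "T \<subseteq> W" "u \<in> T" "\<gamma> \<le> 1"
  shows "test_norm d \<gamma> T u = d"
proof -
  have "finite T" using assms(1,3) finite_sign_vecs finite_subset by metis
  have u: "u \<in> sign_vecs d" using assms(1,3,4) by blast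
  have \<gamma>_le: "\<gamma> * d \<le> d" using mult_right_mono[OF \<open>\<gamma> \<le> 1\<close>, of d] by simp
  have "\<bar>dot d u t\<bar> \<le> d" if "t \<in> T" for t
  proof (cases "t = u")
    case True
    then show ?thesis using u by (simp add: dot_sign_vec_self)
  next
    case False
    then have "\<bar>dot d u t\<bar> \<le> \<gamma> * d"
      using assms(3,4) that by (intro almost_orthogonalD[OF assms(2)]) auto
    then show ?thesis using \<gamma>_le by simp
  qed
  moreover have "real d \<in> (\<lambda>t. \<bar>dot d u t\<bar>) ` T"
    using u \<open>u \<in> T\<close> by (intro image_eqI[of _ _ u]) (simp_all add: dot_sign_vec_self)
  ultimately show ?thesis
    unfolding test_norm_def using \<gamma>_le \<open>finite T\<close> u by (intro Max_eqI) (auto simp: sum_abs_sign_vec)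
qed

subsection \<open>Averaging over the random map\<close>

lemma (in prob_space) exists_outcome_in_many_events:
  assumes "finite W" and events: "\<And>u. u \<in> W \<Longrightarrow> E u \<in> events"
    and q: "\<And>u. u \<in> W \<Longrightarrow> q \<le> prob (E u)"
  shows "\<exists>\<omega>\<in>space M. q * card W \<le> card {u \<in> W. \<omega> \<in> E u}"
proof (rule ccontr)
  assume "\<not> ?thesis"
  moreover have "(\<Sum>u\<in>W. indicator (E u) \<omega>) = real (card {u \<in> W. \<omega> \<in> E u})" for \<omega>
    using \<open>finite W\<close> by (simp add: indicator_def sum.If_cases Int_def)
  ultimately have less: "(\<Sum>u\<in>W. indicator (E u) \<omega>) < q * card W" if "\<omega> \<in> space M" for \<omega>
    using that by (simp add: not_le)
  have integrable: "integrable M (indicator (E u) :: 'a \<Rightarrow> real)" if "u \<in> W" for u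
    using events[OF that] by (intro integrable_real_indicator) (auto simp: emeasure_eq_measure)
  have "q * card W = (\<Sum>u\<in>W. q)" by simp
  also have "\<dots> \<le> (\<Sum>u\<in>W. prob (E u))" by (intro sum_mono q)
  also have "\<dots> = (\<Sum>u\<in>W. expectation (indicator (E u)))"
    using events by (intro sum.cong) auto
  also have "\<dots> = expectation (\<lambda>\<omega>. \<Sum>u\<in>W. indicator (E u) \<omega>)"
    using integrable by (rule Bochner_Integration.integral_sum[symmetric])
  also have "\<dots> < q * card W"
    using integrable less by (intro expectation_less Bochner_Integration.integrable_sum) auto
  finally show False by simp
qed

definition well_embedded ::
  "((nat \<Rightarrow> real) \<Rightarrow> real) \<Rightarrow> ((nat \<Rightarrow> real) \<Rightarrow> real) \<Rightarrow> real \<Rightarrow> ((nat \<Rightarrow> real) \<Rightarrow> nat \<Rightarrow> real)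
    \<Rightarrow> (nat \<Rightarrow> real) set \<Rightarrow> (nat \<Rightarrow> real) set" where
  "well_embedded X U D f W = {u \<in> W. X u \<le> U (f u) \<and> U (f u) \<le> D * X u}"

lemma randomly_embeds_exists_lin_map:
  assumes emb: "randomly_embeds d X d' U D" and W: "finite W" "W \<subseteq> Rn d"
  shows "\<exists>f\<in>lin_maps d d'. 2 / 3 * real (card W) \<le> card (well_embedded X U D f W)"
proof -
  obtain \<mu> where "prob_space \<mu>" and sets: "sets \<mu> = sets (lin_maps_borel d d')" and
    prob: "\<And>x. x \<in> Rn d \<Longrightarrow> 2 / 3 \<le> measure \<mu> {f \<in> space \<mu>. X x \<le> U (f x) \<and> U (f x) \<le> D * X x}"
    using emb unfolding randomly_embeds_def by blast
  interpret prob_space \<mu> by fact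
  let ?E = "\<lambda>u. {f \<in> space \<mu>. X u \<le> U (f u) \<and> U (f u) \<le> D * X u}"
  have "space \<mu> = lin_maps d d'"
    using sets_eq_imp_space_eq[OF sets] by (simp add: lin_maps_borel_def space_measure_of_conv)
  \<comment> \<open>Non-measurable sets have \<open>measure\<close> 0, so the probability bound entails measurability.\<close>
  moreover have "?E u \<in> events" if "u \<in> W" for u
    using prob[of u] that W measure_notin_sets[of "?E u" \<mu>] by force
  then obtain f where "f \<in> space \<mu>" "2 / 3 * card W \<le> card {u \<in> W. f \<in> ?E u}"
    using exists_outcome_in_many_events[OF W(1), of ?E "2 / 3"] prob W(2) by blast
  ultimately show ?thesis
    by (intro bexI[of _ f]) (simp_all add: well_embedded_def)
qed

lemma randomly_embeds_distortion_ge_1: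
  assumes emb: "randomly_embeds d X d' U D" and X: "norm_on d X" and "0 < d"
  shows "1 \<le> D"
proof -
  let ?x = "basis_vec 0"
  have x: "?x \<in> Rn d" "?x \<noteq> (\<lambda>_. 0)"
    using \<open>0 < d\<close> by (auto simp: basis_vec_in_Rn basis_vec_def fun_eq_iff)
  then have "0 < X ?x" using X by (metis norm_on_def order_le_less)
  obtain f where "2 / 3 * real (card {?x}) \<le> card (well_embedded X U D f {?x})"
    using randomly_embeds_exists_lin_map[OF emb, of "{?x}"] x(1) by auto
  then have "well_embedded X U D f {?x} \<noteq> {}" by auto
  then have "X ?x \<le> D * X ?x" by (auto simp: well_embedded_def)
  then show ?thesis using \<open>0 < X ?x\<close> by simp
qed

subsection \<open>Counting traces\<close>

lemma card_le_card_traces: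
  assumes "finite W" "\<A> \<subseteq> Pow W" "S \<subseteq> W"
  shows "card \<A> \<le> card ((\<lambda>T. T \<inter> S) ` \<A>) * 2 ^ card (W - S)"
proof -
  have "finite \<A>" using assms(1,2) finite_subset by blast
  have "inj_on (\<lambda>T. (T \<inter> S, T - S)) \<A>" by (auto simp: inj_on_def)
  moreover have "(\<lambda>T. (T \<inter> S, T - S)) ` \<A> \<subseteq> ((\<lambda>T. T \<inter> S) ` \<A>) \<times> Pow (W - S)"
    using assms(2) by auto
  ultimately have "card \<A> \<le> card (((\<lambda>T. T \<inter> S) ` \<A>) \<times> Pow (W - S))"
    using \<open>finite \<A>\<close> \<open>finite W\<close> by (intro card_inj_on_le) auto
  then show ?thesis using \<open>finite W\<close> by (simp add: card_cartesian_product card_Pow)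
qed

lemma sum_two_power_card_diff:
  assumes "finite W"
  shows "(\<Sum>S\<in>Pow W. 2 ^ card (W - S)) = (3::real) ^ card W"
  using prod_add[OF assms, of "\<lambda>_. 1::real" "\<lambda>_. 2"] by simp

lemma sum_two_power_card_eq_sum_supersets:
  assumes "finite W" and G: "\<And>T. T \<subseteq> W \<Longrightarrow> G T \<subseteq> W"
  shows "(\<Sum>T\<in>Pow W. 2 ^ card (G T)) = (\<Sum>S\<in>Pow W. card {T \<in> Pow W. S \<subseteq> G T})"
proof -
  have "(\<Sum>T\<in>Pow W. 2 ^ card (G T)) = (\<Sum>T\<in>Pow W. card {S \<in> Pow W. S \<subseteq> G T})"
  proof (rule sum.cong)
    fix T assume "T \<in> Pow W"
    then have "{S \<in> Pow W. S \<subseteq> G T} = Pow (G T)" "finite (G T)"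
      using G[of T] \<open>finite W\<close> finite_subset by auto
    then show "2 ^ card (G T) = card {S \<in> Pow W. S \<subseteq> G T}" by (simp add: card_Pow)
  qed simp
  also have "\<dots> = (\<Sum>S\<in>Pow W. card {T \<in> Pow W. S \<subseteq> G T})"
    using \<open>finite W\<close> by (intro sum_multicount_gen) auto
  finally show ?thesis .
qed

lemma trace_count_lower_bound:
  fixes G :: "'a set \<Rightarrow> 'a set" and M \<theta> :: real
  assumes "finite W" and G: "\<And>T. T \<subseteq> W \<Longrightarrow> G T \<subseteq> W"
    and large: "\<And>T. T \<subseteq> W \<Longrightarrow> \<theta> * card W \<le> card (G T)"
    and traces: "\<And>S. S \<subseteq> W \<Longrightarrow> real (card ((\<lambda>T. T \<inter> S) ` {T \<in> Pow W. S \<subseteq> G T})) \<le> M"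
  shows "2 powr ((1 + \<theta>) * card W) \<le> M * 3 ^ card W"
proof -
  have "2 powr ((1 + \<theta>) * card W) = (\<Sum>T\<in>Pow W. 2 powr (\<theta> * card W))"
    using \<open>finite W\<close> by (simp add: card_Pow distrib_right powr_add powr_realpow)
  also have "\<dots> \<le> (\<Sum>T\<in>Pow W. 2 powr card (G T))"
    using large by (intro sum_mono powr_mono) auto
  also have "\<dots> = real (\<Sum>T\<in>Pow W. 2 ^ card (G T))"
    by (simp add: powr_realpow)
  also have "\<dots> = (\<Sum>S\<in>Pow W. real (card {T \<in> Pow W. S \<subseteq> G T}))"
    using sum_two_power_card_eq_sum_supersets[OF \<open>finite W\<close>, of G] G by simp
  also have "\<dots> \<le> (\<Sum>S\<in>Pow W. M * 2 ^ card (W - S))"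
  proof (rule sum_mono)
    fix S assume "S \<in> Pow W"
    let ?\<A> = "{T \<in> Pow W. S \<subseteq> G T}"
    have "real (card ?\<A>) \<le> real (card ((\<lambda>T. T \<inter> S) ` ?\<A>) * 2 ^ card (W - S))"
      using \<open>S \<in> Pow W\<close> \<open>finite W\<close> by (intro of_nat_mono card_le_card_traces) auto
    also have "\<dots> \<le> M * 2 ^ card (W - S)"
      using \<open>S \<in> Pow W\<close> traces[of S] by (simp add: mult_right_mono)
    finally show "real (card ?\<A>) \<le> M * 2 ^ card (W - S)" .
  qed
  also have "\<dots> = M * 3 ^ card W"
    using sum_two_power_card_diff[OF \<open>finite W\<close>] by (simp flip: sum_distrib_left)
  finally show ?thesis .
qed

subsection \<open>Randomly universal spaces\<close>

definition randomly_universal :: "nat \<Rightarrow> real \<Rightarrow> nat \<Rightarrow> ((nat \<Rightarrow> real) \<Rightarrow> real) \<Rightarrow> bool" where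
  "randomly_universal d D d' U \<longleftrightarrow>
     norm_on d' U \<and> (\<forall>X. norm_on d X \<longrightarrow> randomly_embeds d X d' U D)"

lemma randomly_universal_distortion_ge_1:
  assumes "randomly_universal d D d' U" "0 < d"
  shows "1 \<le> D"
proof -
  have X: "norm_on d (test_norm d 1 {})" by (rule norm_on_test_norm) simp_all
  then have "randomly_embeds d (test_norm d 1 {}) d' U D"
    using assms(1) by (simp add: randomly_universal_def)
  then show ?thesis using X assms(2) by (rule randomly_embeds_distortion_ge_1)
qed

lemma card_well_embedded_traces_le:
  assumes U: "norm_on d' U" and "0 < d" "1 \<le> D" "\<gamma> = 1 / (2 * D)"
    and W: "W \<subseteq> sign_vecs d" "almost_orthogonal d \<gamma> W" and "S \<subseteq> W"
    and F: "\<And>T. T \<subseteq> W \<Longrightarrow> F T \<in> lin_maps d d'"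
  shows "real (card ((\<lambda>T. T \<inter> S) `
      {T \<in> Pow W. S \<subseteq> well_embedded (test_norm d \<gamma> T) U D (F T) W}))
    \<le> (4 ^ Suc (d' * d) * (2 * D)) ^ (d' * d)" (is "real (card (?traces ` ?\<T>)) \<le> _")
proof -
  have \<gamma>: "\<gamma> \<le> 1" "D * (\<gamma> * d) = d / 2" using assms(3,4) by simp_all
  have d_le: "d \<le> D * d" using mult_right_mono[OF \<open>1 \<le> D\<close>, of d] by simp
  have finite_W: "finite W" using W(1) finite_sign_vecs by (rule finite_subset)
  have "real (card (?traces ` ?\<T>)) \<le> (4 ^ Suc (d' * d) * (D * d / (d / 2))) ^ (d' * d)"
  proof (rule card_traces_le[OF U, where F = F and s = "d / 2"])
    fix T u assume "T \<in> ?\<T>" "u \<in> S"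
    then have T: "T \<subseteq> W" "u \<in> W" and embedded: "test_norm d \<gamma> T u \<le> U (F T u)"
      "U (F T u) \<le> D * test_norm d \<gamma> T u"
      by (auto simp: well_embedded_def)
    show "d / 2 + d / 2 \<le> U (F T u)" if "u \<in> T"
      using embedded(1) test_norm_inside[OF W T(1) that \<gamma>(1)] by simp
    show outside: "U (F T u) \<le> d / 2" if "u \<notin> T"
      using embedded(2) test_norm_outside[OF W T(1), of u] T(2) that \<gamma>(2) by simp
    show "U (F T u) \<le> D * d"
      using embedded(2) outside d_le test_norm_inside[OF W T(1) _ \<gamma>(1)] by (cases "u \<in> T") auto
  next
    show "d / 2 \<le> 2 * (D * d)" using d_le by simp
  next
    show "finite S" "S \<subseteq> Rn d"
      using \<open>S \<subseteq> W\<close> W(1) finite_W sign_vecs_in_Rn by (auto intro: finite_subset)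
  qed (use finite_W F \<open>0 < d\<close> in auto)
  then show ?thesis using \<open>0 < d\<close> by (simp add: mult.commute)
qed

lemma randomly_universal_powr_card_le:
  assumes univ: "randomly_universal d D d' U" and "0 < d"
    and W: "W \<subseteq> sign_vecs d" "almost_orthogonal d (1 / (2 * D)) W"
  shows "2 powr (5 / 3 * card W) \<le> (4 ^ Suc (d' * d) * (2 * D)) ^ (d' * d) * 3 ^ card W"
proof -
  define \<gamma> where "\<gamma> = 1 / (2 * D)"
  have D: "1 \<le> D" using univ \<open>0 < d\<close> by (rule randomly_universal_distortion_ge_1)
  have finite_W: "finite W" using W(1) finite_sign_vecs by (rule finite_subset)
  have "\<forall>T\<in>Pow W. \<exists>f. f \<in> lin_maps d d' \<and>
      2 / 3 * real (card W) \<le> card (well_embedded (test_norm d \<gamma> T) U D f W)"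
  proof
    fix T assume "T \<in> Pow W"
    then have "norm_on d (test_norm d \<gamma> T)"
      using finite_W D by (intro norm_on_test_norm) (auto simp: \<gamma>_def finite_subset)
    then have "randomly_embeds d (test_norm d \<gamma> T) d' U D"
      using univ by (simp add: randomly_universal_def)
    then show "\<exists>f. f \<in> lin_maps d d' \<and>
        2 / 3 * real (card W) \<le> card (well_embedded (test_norm d \<gamma> T) U D f W)"
      using randomly_embeds_exists_lin_map[OF _ finite_W] W(1) sign_vecs_in_Rn by blast
  qed
  then obtain F where F: "\<forall>T\<in>Pow W. F T \<in> lin_maps d d' \<and>
      2 / 3 * real (card W) \<le> card (well_embedded (test_norm d \<gamma> T) U D (F T) W)"
    by (rule bchoice[THEN exE])
  have "2 powr ((1 + 2 / 3) * card W) \<le> (4 ^ Suc (d' * d) * (2 * D)) ^ (d' * d) * 3 ^ card W"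
  proof (rule trace_count_lower_bound[OF finite_W])
    show "well_embedded (test_norm d \<gamma> T) U D (F T) W \<subseteq> W" for T
      by (auto simp: well_embedded_def)
    show "2 / 3 * real (card W) \<le> card (well_embedded (test_norm d \<gamma> T) U D (F T) W)"
      if "T \<subseteq> W" for T
      using F that by blast
  qed (use univ \<open>0 < d\<close> D W F in
      \<open>intro card_well_embedded_traces_le, auto simp: \<gamma>_def randomly_universal_def\<close>)
  then show ?thesis by simp
qed

lemma ln_3_le: "ln 3 + 5 / 96 \<le> 5 / 3 * ln (2::real)"
proof -
  have "ln (27 / 32) \<le> 27 / 32 - (1::real)" by (rule ln_le_minus_one) simp
  moreover have "ln (27 / 32 :: real) = 3 * ln 3 - 5 * ln 2"
    using ln_div[of "3 ^ 3 :: real" "2 ^ 5"]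
      ln_realpow[of "3 :: real" 3] ln_realpow[of "2 :: real" 5] by simp
  ultimately show ?thesis by simp
qed

lemma randomly_universal_card_le:
  assumes univ: "randomly_universal d D d' U" and "0 < d" "D \<le> d"
    and W: "W \<subseteq> sign_vecs d" "almost_orthogonal d (1 / (2 * D)) W"
  shows "5 / 96 * real (card W) \<le> 7 * (real d' * real d)\<^sup>2"
proof -
  define n where "n = d' * d"
  have D: "1 \<le> D" using univ \<open>0 < d\<close> by (rule randomly_universal_distortion_ge_1)
  have "ln (2 powr (5 / 3 * card W)) \<le> ln ((4 ^ Suc n * (2 * D)) ^ n * 3 ^ card W)"
    using randomly_universal_powr_card_le[OF univ \<open>0 < d\<close> W] D
    by (subst ln_le_cancel_iff) (auto simp: n_def)
  also have "\<dots> = n * (Suc n * ln 4 + ln (2 * D)) + card W * ln 3"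
    using D by (simp add: ln_mult_pos ln_realpow del: power_Suc of_nat_Suc)
  finally have "card W * (5 / 3 * ln 2 - ln 3) \<le> n * (Suc n * ln 4 + ln (2 * D))"
    by (simp add: ln_powr algebra_simps)
  moreover have "card W * (5 / 96) \<le> card W * (5 / 3 * ln 2 - ln (3::real))"
    using ln_3_le by (intro mult_left_mono) auto
  moreover have "real n * (Suc n * ln 4 + ln (2 * D)) \<le> real n * (7 * real n)"
  proof (cases "n = 0")
    case False
    then have "1 \<le> n" "d \<le> n" by (simp_all add: n_def)
    then have n: "1 \<le> real n" "D \<le> n" using \<open>D \<le> d\<close> by simp_all
    have "Suc n * ln 4 \<le> Suc n * (3::real)"
      using ln_le_minus_one[of "4::real"] by (intro mult_left_mono) auto
    moreover have "ln (2 * D) \<le> 2 * D - 1" using D by (intro ln_le_minus_one) simp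
    ultimately have "Suc n * ln 4 + ln (2 * D) \<le> 7 * real n" using n by simp
    then show ?thesis by (intro mult_left_mono) auto
  qed simp
  ultimately show ?thesis by (simp add: n_def power2_eq_square)
qed

lemma randomly_universal_dimension_bound:
  assumes univ: "randomly_universal d D d' U" and "0 < d" "D \<le> d"
  shows "exp (d / (16 * D\<^sup>2)) \<le> 17 * real d * real d'"
proof -
  have D: "1 \<le> D" using univ \<open>0 < d\<close> by (rule randomly_universal_distortion_ge_1)
  obtain W where W: "W \<subseteq> sign_vecs d" "almost_orthogonal d (1 / (2 * D)) W"
    and large: "exp ((1 / (2 * D))\<^sup>2 * d / 2) \<le> 2 * real (card W)"
    using exists_large_almost_orthogonal_sign_vecs[of d "1 / (2 * D)"] \<open>0 < d\<close> D by auto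
  have "(exp (d / (16 * D\<^sup>2)))\<^sup>2 = exp ((1 / (2 * D))\<^sup>2 * d / 2)"
    by (simp add: power2_eq_square flip: exp_add)
  also have "\<dots> \<le> 2 * real (card W)" by (rule large)
  also have "\<dots> \<le> 17\<^sup>2 * (real d' * real d)\<^sup>2"
    using randomly_universal_card_le[OF univ \<open>0 < d\<close> \<open>D \<le> d\<close> W] by simp
  also have "\<dots> = (17 * real d * real d')\<^sup>2"
    by (simp add: power_mult_distrib)
  finally show ?thesis by (rule power2_le_imp_le) simp
qed

lemma powr_le_divide_square:
  fixes D K x :: real
  assumes "0 < x" "1 \<le> D" "D \<le> K * x powr (1 / 2 - \<epsilon>)"
  shows "x powr (2 * \<epsilon>) / K\<^sup>2 \<le> x / D\<^sup>2"
proof -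
  have "D\<^sup>2 \<le> (K * x powr (1 / 2 - \<epsilon>))\<^sup>2" using assms by (intro power_mono) auto
  also have "\<dots> = K\<^sup>2 * x powr (1 - 2 * \<epsilon>)"
    by (simp add: power_mult_distrib power2_eq_square flip: powr_add)
  finally have "x powr (2 * \<epsilon>) * D\<^sup>2 \<le> x powr (2 * \<epsilon>) * (K\<^sup>2 * x powr (1 - 2 * \<epsilon>))"
    by (rule mult_left_mono) simp
  also have "\<dots> = x * K\<^sup>2"
    using \<open>0 < x\<close> by (simp add: mult.left_commute flip: powr_add)
  finally have "x powr (2 * \<epsilon>) * D\<^sup>2 \<le> x * K\<^sup>2" .
  moreover have "K \<noteq> 0" using assms by auto
  ultimately show ?thesis using \<open>1 \<le> D\<close> by (simp add: frac_le_eq field_simps)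
qed

lemma randomly_universal_dimension_ge_exp:
  assumes univ: "randomly_universal d D d' U" and "0 < d" and c: "c = 1 / (32 * K\<^sup>2)"
    and D: "D \<le> K * real d powr (1 / 2 - \<epsilon>)" "K * real d powr (1 / 2 - \<epsilon>) \<le> d"
    and large: "17 * real d \<le> exp (c * real d powr (2 * \<epsilon>))" (is "_ \<le> ?e")
  shows "exp (c * real d powr (2 * \<epsilon>)) \<le> d'"
proof -
  have "1 \<le> D" using univ \<open>0 < d\<close> by (rule randomly_universal_distortion_ge_1)
  then have "2 * (c * real d powr (2 * \<epsilon>)) \<le> d / (16 * D\<^sup>2)"
    using powr_le_divide_square[OF _ _ D(1)] \<open>0 < d\<close> by (simp add: c)
  then have "?e * ?e \<le> exp (d / (16 * D\<^sup>2))" by (simp flip: exp_add)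
  also have "\<dots> \<le> 17 * real d * real d'"
    using univ \<open>0 < d\<close> D by (intro randomly_universal_dimension_bound) auto
  also have "\<dots> \<le> ?e * d'" using large by (rule mult_right_mono) simp
  finally show ?thesis by simp
qed

theorem theorem6p1:
  fixes \<epsilon> :: real and D :: "nat \<Rightarrow> real"
  assumes "\<epsilon> > 0"
    and "D \<in> O(\<lambda>d. real d powr (1 / 2 - \<epsilon>))"
  shows "\<exists>c>0. \<forall>\<^sub>F d in sequentially.
           \<forall>d' U. norm_on d' U \<longrightarrow> (\<forall>X. norm_on d X \<longrightarrow> randomly_embeds d X d' U (D d)) \<longrightarrow>
             real d' \<ge> exp (c * real d powr (2 * \<epsilon>))"
proof -
  obtain K where "K > 0"
    and D: "\<forall>\<^sub>F d in sequentially. norm (D d) \<le> K * norm (real d powr (1 / 2 - \<epsilon>))"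
    using assms(2) by (rule landau_o.bigE)
  define c where "c = 1 / (32 * K\<^sup>2)"
  have "c > 0" using \<open>K > 0\<close> by (simp add: c_def)
  have "\<forall>\<^sub>F d in sequentially. K * real d powr (1 / 2 - \<epsilon>) \<le> d"
    "\<forall>\<^sub>F d in sequentially. 17 * real d \<le> exp (c * real d powr (2 * \<epsilon>))"
    using \<open>\<epsilon> > 0\<close> \<open>K > 0\<close> \<open>c > 0\<close> by real_asymp+
  with D eventually_gt_at_top[of 0]
  have "\<forall>\<^sub>F d in sequentially.
      \<forall>d' U. randomly_universal d (D d) d' U \<longrightarrow> exp (c * real d powr (2 * \<epsilon>)) \<le> d'"
  proof eventually_elim
    case (elim d)
    then show ?case
      by (intro allI impI randomly_universal_dimension_ge_exp[where D = "D d", OF _ _ c_def]) auto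
  qed
  then show ?thesis
    using \<open>c > 0\<close> unfolding randomly_universal_def imp_conjL by blast
qed

end
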